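(* For every integer $d\ge 2$, the Keller graph $G_d$ is Hamiltonian.
   Context: The Keller graph $G_d$ has as vertices the $4^d$ tuples in $\{0,1,2,3\}^d$; two tuples $u,v$ are adjacent iff they differ in at least two coordinates and there is at least one coordinate $i$ with $u_i-v_i\equiv 2\pmod 4$. *)

theory Defs
  imports "Graph_Theory.Pair_Digraph" "HOL-Number_Theory.Cong"
begin

text \<open>
  Undirected simple graphs are represented as symmetric loop-free digraphs without
  parallel arcs (locale \<^locale>\<open>pair_graph\<close>). In such a digraph the two
  arcs of a single edge form a \<^const>\<open>pre_digraph.cycle\<close> of length 2, so a cycle of the
  underlying undirected graph is one of length at least 3.
\<close>

definition (in pre_digraph) hamiltonian_cycle :: "'b awalk \<Rightarrow> bool" where
  "hamiltonian_cycle p \<longleftrightarrow>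
     cycle p \<and> 3 \<le> length p \<and> set (awalk_verts (tail G (hd p)) p) = verts G"

definition (in pre_digraph) hamiltonian :: bool where
  "hamiltonian \<longleftrightarrow> (\<exists>p. hamiltonian_cycle p)"

definition keller_verts :: "nat \<Rightarrow> nat list set" where
  "keller_verts d = {u. length u = d \<and> set u \<subseteq> {0, 1, 2, 3}}"

definition keller_adj :: "nat \<Rightarrow> nat list \<Rightarrow> nat list \<Rightarrow> bool" where
  "keller_adj d u v \<longleftrightarrow>
     2 \<le> card {i. i < d \<and> u ! i \<noteq> v ! i} \<and>
     (\<exists>i<d. [int (u ! i) - int (v ! i) = 2] (mod 4))"

definition keller_graph :: "nat \<Rightarrow> nat list pair_pre_digraph" where
  "keller_graph d = \<lparr>
     pverts = keller_verts d,
     parcs = {(u, v). u \<in> keller_verts d \<and> v \<in> keller_verts d \<and> keller_adj d u v} \<rparr>"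

lemma finite_keller_verts: "finite (keller_verts d)"
  and card_keller_verts: "card (keller_verts d) = 4 ^ d"
proof -
  have *: "keller_verts d = {u. set u \<subseteq> {0, 1, 2, 3} \<and> length u = d}"
    by (auto simp: keller_verts_def)
  show "finite (keller_verts d)"
    unfolding * by (rule finite_lists_length_eq) simp
  have "card (keller_verts d) = card {0, 1, 2, 3 :: nat} ^ d"
    unfolding * by (rule card_lists_length_eq) simp
  then show "card (keller_verts d) = 4 ^ d"
    by (simp add: numeral_eq_Suc)
qed

lemma keller_adj_sym:
  assumes "keller_adj d u v"
  shows "keller_adj d v u"
proof -
  have "[b - a = 2] (mod 4)" if "[a - b = 2] (mod 4)" for a b :: int
    using that unfolding cong_def by presburger
  moreover have "{i. i < d \<and> v ! i \<noteq> u ! i} = {i. i < d \<and> u ! i \<noteq> v ! i}"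
    by auto
  ultimately show ?thesis
    using assms unfolding keller_adj_def by auto
qed

lemma keller_adj_irrefl: "\<not> keller_adj d u u"
  by (simp add: keller_adj_def)

lemma pair_graph_keller_graph: "pair_graph (keller_graph d)"
proof
  have "parcs (keller_graph d) \<subseteq> keller_verts d \<times> keller_verts d"
    by (auto simp: keller_graph_def)
  then show "finite (parcs (keller_graph d))"
    using finite_keller_verts by (blast intro: finite_subset finite_SigmaI)
  show "symmetric (with_proj (keller_graph d))"
    unfolding symmetric_def by (auto simp: keller_graph_def sym_def dest: keller_adj_sym)
qed (auto simp: keller_graph_def finite_keller_verts keller_adj_irrefl)

end

theory Submission
  imports Defs "Graph_Theory.Vertex_Walk"
begin

text \<open>
  Adjacent vertices of \<open>G\<^sub>d\<close> stay adjacent after prefixing arbitrary coordinates, so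
  \<open>G\<close> in dimension \<open>d + 1\<close> contains the blow-up of \<open>G\<^sub>d\<close> in which each vertex
  is replaced by four. Going round a Hamiltonian cycle of \<open>G\<^sub>d\<close> four times, with the
  new coordinate equal to \<open>0, 1, 2, 3\<close> in turn, therefore gives a Hamiltonian cycle one
  dimension higher. For \<open>d = 2\<close>, writing \<open>s = (1, 2)\<close> and \<open>t = (2, 1)\<close>, the step
  sequence \<open>s, s, s, t\<close> repeated four times works: \<open>s\<close> has order 4 in
  \<open>\<int>\<^sub>4\<^sup>2\<close>, and \<open>t\<close> generates the quotient by the subgroup spanned by \<open>s\<close>.
\<close>

lemma awalk_verts_vwalk_arcs:
  "pre_digraph.awalk_verts (with_proj G) u (vwalk_arcs (u # w)) = u # w"
  by (induction w arbitrary: u) (simp_all add: pre_digraph.awalk_verts.simps)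

lemma cas_vwalk_arcs:
  "pre_digraph.cas (with_proj G) u (vwalk_arcs (u # w)) (last (u # w))"
  by (induction w arbitrary: u) (simp_all add: pre_digraph.cas.simps)

lemma set_vwalk_arcs_subset_iff:
  "set (vwalk_arcs w) \<subseteq> R \<longleftrightarrow> successively (\<lambda>u v. (u, v) \<in> R) w"
  by (induction w rule: vwalk_arcs.induct) auto

text \<open>A closed walk is given by its vertex list, the start vertex being listed only at the end.\<close>

lemma hamiltonian_if_vertex_list:
  assumes "distinct w" "set w = pverts G" "3 \<le> length w"
    and adj: "successively (\<lambda>u v. (u, v) \<in> parcs G) (last w # w)"
  shows "pre_digraph.hamiltonian (with_proj G)"
proof -
  define p where "p = vwalk_arcs (last w # w)"
  have "w \<noteq> []"
    using assms(3) by auto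
  then have last: "last w \<in> set w" "last (last w # w) = last w"
    by auto
  have len: "length p = length w"
    using vwalk_length_simp[of "last w # w"] by (simp only: p_def vwalk_length_def list.size)
  have verts: "pre_digraph.awalk_verts (with_proj G) (last w) p = last w # w"
    by (simp only: p_def awalk_verts_vwalk_arcs)
  have cas: "pre_digraph.cas (with_proj G) (last w) p (last w)"
    using cas_vwalk_arcs[of G "last w" w] last by (simp only: p_def)
  have "set p \<subseteq> parcs G"
    using adj by (simp only: p_def set_vwalk_arcs_subset_iff)
  with cas last assms(2) have "pre_digraph.awalk (with_proj G) (last w) p (last w)"
    by (simp add: pre_digraph.awalk_def)
  moreover have "p \<noteq> []"
    using len \<open>w \<noteq> []\<close> by auto
  \<comment> \<open>\<open>cycle\<close> asks for distinctness of the tail of the vertex sequence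
    \<open>last w # w\<close>, which is \<open>w\<close> itself.\<close>
  ultimately have "pre_digraph.cycle (with_proj G) p"
    unfolding pre_digraph.cycle_def using verts assms(1) by (intro exI[of _ "last w"]) simp
  moreover have "fst (hd p) = last w"
    using \<open>w \<noteq> []\<close> by (simp add: p_def)
  ultimately show ?thesis
    unfolding pre_digraph.hamiltonian_def pre_digraph.hamiltonian_cycle_def
    using len verts last assms(2,3) by (intro exI[of _ p]) auto
qed

lemma keller_verts_Suc: "keller_verts (Suc d) = (\<Union>a\<in>{0, 1, 2, 3}. (#) a ` keller_verts d)"
  by (auto simp: keller_verts_def length_Suc_conv)

text \<open>Differing coordinates, and one differing by 2, survive with index shifted by one,
  whatever \<open>a\<close> and \<open>b\<close> are. The case \<open>a = b\<close> serves inside a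
  copy, \<open>a \<noteq> b\<close> between copies.\<close>

lemma keller_adj_Cons:
  assumes "keller_adj d u v"
  shows "keller_adj (Suc d) (a # u) (b # v)"
proof -
  have "2 \<le> card {i. i < d \<and> u ! i \<noteq> v ! i}"
    using assms by (simp add: keller_adj_def)
  also have "\<dots> = card (Suc ` {i. i < d \<and> u ! i \<noteq> v ! i})"
    by (simp add: card_image)
  also have "\<dots> \<le> card {i. i < Suc d \<and> (a # u) ! i \<noteq> (b # v) ! i}"
    by (intro card_mono) auto
  finally show ?thesis
    using assms by (auto simp: keller_adj_def intro: exI[of _ "Suc _"])
qed

lemma keller_adj_2I:
  assumes "a \<noteq> c" "b \<noteq> e" "[int a - int c = 2] (mod 4) \<or> [int b - int e = 2] (mod 4)"
  shows "keller_adj 2 [a, b] [c, e]"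
proof -
  have "{i. i < 2 \<and> [a, b] ! i \<noteq> [c, e] ! i} = {0, 1}"
    using assms(1,2) by (auto simp: less_2_cases_iff)
  moreover have "\<exists>i<2. [int ([a, b] ! i) - int ([c, e] ! i) = 2] (mod 4)"
    using assms(3)
  proof
    assume "[int a - int c = 2] (mod 4)"
    then show ?thesis
      by (intro exI[of _ 0]) simp
  next
    assume "[int b - int e = 2] (mod 4)"
    then show ?thesis
      by (intro exI[of _ 1]) simp
  qed
  ultimately show ?thesis
    unfolding keller_adj_def by simp
qed

text \<open>Putting \<open>last w\<close> in front makes the closing edge one of the consecutive
  pairs.\<close>

definition keller_cycle :: "nat \<Rightarrow> nat list list \<Rightarrow> bool" where
  "keller_cycle d w \<longleftrightarrow>
     distinct w \<and> set w = keller_verts d \<and> successively (keller_adj d) (last w # w)"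

text \<open>Each block of four consecutive entries is a coset of the subgroup spanned by
  \<open>s\<close>: second coordinate minus twice the first is 0, 1, 2, 3 mod 4 on the successive
  blocks. Step \<open>t\<close> leads to the next block, and from the last entry back to the
  first.\<close>

lemma keller_cycle_2:
  "keller_cycle 2
     [[0, 0], [1, 2], [2, 0], [3, 2], [1, 3], [2, 1], [3, 3], [0, 1],
      [2, 2], [3, 0], [0, 2], [1, 0], [3, 1], [0, 3], [1, 1], [2, 3]]"
  (is "keller_cycle 2 ?w")
proof -
  have "distinct ?w"
    by simp
  moreover have "set ?w = keller_verts 2"
  proof (rule card_subset_eq)
    show "set ?w \<subseteq> keller_verts 2"
      by (simp add: keller_verts_def)
    show "card (set ?w) = card (keller_verts 2)"
      using distinct_card[OF \<open>distinct ?w\<close>] by (simp add: card_keller_verts)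
  qed (rule finite_keller_verts)
  moreover have "successively (keller_adj 2) (last ?w # ?w)"
    by (simp add: keller_adj_2I cong_def)
  ultimately show ?thesis
    by (simp only: keller_cycle_def)
qed

lemma keller_cycle_Suc:
  assumes "keller_cycle d w"
  shows "keller_cycle (Suc d) (map ((#) 0) w @ map ((#) 1) w @ map ((#) 2) w @ map ((#) 3) w)"
proof -
  have "w \<noteq> []"
  proof
    assume "w = []"
    then have "keller_verts d = {}"
      using assms unfolding keller_cycle_def by simp
    then show False
      using card_keller_verts[of d] by simp
  qed
  have adj: "keller_adj d (last w) (hd w)" "successively (keller_adj d) w"
    using assms \<open>w \<noteq> []\<close> unfolding keller_cycle_def successively_Cons by blast+
  let ?w = "map ((#) 0) w @ map ((#) 1) w @ map ((#) 2) w @ map ((#) 3) w"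
  have "distinct ?w"
    using assms by (auto simp: keller_cycle_def distinct_map)
  moreover have "set ?w = keller_verts (Suc d)"
    using assms by (simp add: keller_cycle_def keller_verts_Suc)
  moreover have "successively (keller_adj (Suc d)) (last ?w # ?w)"
  proof -
    have "successively (keller_adj (Suc d)) (map ((#) a) w)" for a
      unfolding successively_map by (rule successively_mono[OF adj(2) keller_adj_Cons])
    \<comment> \<open>All four junctions, including that from copy 3 back to copy 0, lift the edge
      from \<open>last w\<close> to \<open>hd w\<close>.\<close>
    moreover have "keller_adj (Suc d) (last (map ((#) a) w)) (hd (map ((#) b) w))" for a b
      unfolding last_map[OF \<open>w \<noteq> []\<close>] hd_map[OF \<open>w \<noteq> []\<close>]
      using adj(1) by (rule keller_adj_Cons)
    ultimately show ?thesis
      using \<open>w \<noteq> []\<close>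
      unfolding successively_Cons successively_append_iff
      by (simp only: last_appendR hd_append2 append_is_Nil_conv map_is_Nil_conv simp_thms)
  qed
  ultimately show ?thesis
    by (simp only: keller_cycle_def)
qed

lemma ex_keller_cycle:
  assumes "2 \<le> d"
  shows "\<exists>w. keller_cycle d w"
  using assms
proof (induction rule: dec_induct)
  case base
  show ?case
    by (rule exI, rule keller_cycle_2)
next
  case (step n)
  then obtain w where "keller_cycle n w"
    by blast
  then show ?case
    by (intro exI, rule keller_cycle_Suc)
qed

theorem theorem17:
  fixes d :: nat
  assumes "d \<ge> 2"
  shows "pre_digraph.hamiltonian (with_proj (keller_graph d))"
proof -
  obtain w where w: "distinct w" "set w = keller_verts d"
      "successively (keller_adj d) (last w # w)"
    using ex_keller_cycle[OF assms] by (auto simp: keller_cycle_def)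
  have len: "length w = 4 ^ d"
    using distinct_card[OF w(1)] unfolding w(2) card_keller_verts by (rule sym)
  have "(4::nat) ^ 1 \<le> 4 ^ d"
    using assms by (intro power_increasing) auto
  then have "3 \<le> length w"
    using len by simp
  \<comment> \<open>Arcs need both ends in \<open>keller_verts d\<close>;
    \<open>successively_mono\<close> only provides that they are entries of
    \<open>last w # w\<close>.\<close>
  then have "last w \<in> set w"
    by (intro last_in_set) auto
  then have "successively (\<lambda>u v. (u, v) \<in> parcs (keller_graph d)) (last w # w)"
    using w(2) by (intro successively_mono[OF w(3)]) (auto simp: keller_graph_def)
  then show ?thesis
    using w \<open>3 \<le> length w\<close> by (intro hamiltonian_if_vertex_list) (auto simp: keller_graph_def)
qed

end
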